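(* Let $S$ be a pomonoid and let $f:A_S\to B_S$ be an $S$-poset map between right $S$-posets. If $f$ is an Emb-injective object in the slice category $\mathbf{Pos}\text{-}S/B_S$ and $B_S$ is a generator in $\mathbf{Pos}\text{-}S$, then $A_S$ is a generator in $\mathbf{Pos}\text{-}S$. Further, ${}_{\mathrm{End}(A_S)}A$ is a cyclic projective object in $\mathrm{End}(A_S)\text{-}\mathbf{Pos}$.
   Context: A pomonoid is a monoid $S$ with a partial order $\leq$ such that $s\leq t$ and $s'\leq t'$ imply $ss'\leq tt'$. A (right) $S$-poset is a poset $A$ with a right monoid action $A\times S\to A$ that is order-preserving for the componentwise order on $A\times S$. $\mathbf{Pos}\text{-}S$ is the category of right $S$-posets with monotone action-preserving maps ($S$-poset maps); for a pomonoid $T$, $T\text{-}\mathbf{Pos}$ is the analogous category of left $T$-posets. An object $G$ is a generator if for any two distinct morphisms $\alpha,\beta:X\to Y$ there is a morphism $g:G\to X$ with $\alpha g\neq\beta g$. Projective means projective with respect to epimorphisms, which are exactly the surjective morphisms; a left $T$-poset $A$ is cyclic if $A=Ta$ for some $a\in A$; cyclic projective means cyclic and projective. $\mathrm{End}(A_S)$ is the pomonoid of all $S$-poset maps $A_S\to A_S$ under composition with pointwise order, and ${}_{\mathrm{End}(A_S)}A$ is $A$ with the left action $h\cdot a=h(a)$. Objects of $\mathbf{Pos}\text{-}S/B_S$ are $S$-poset maps with codomain $B_S$; morphisms from $p:D\to B_S$ to $q:E\to B_S$ are $S$-poset maps $h:D\to E$ with $qh=p$. Emb is the class of order-embeddings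 ($S$-poset maps $h$ with $h(x)\leq h(y)\iff x\leq y$). An object $f:A_S\to B_S$ is Emb-injective in $\mathbf{Pos}\text{-}S/B_S$ if for every order-embedding $h:U\to V$ of $S$-posets and $S$-poset maps $u:U\to A_S$, $v:V\to B_S$ with $fu=vh$, there is an $S$-poset map $s:V\to A_S$ with $sh=u$ and $fs=v$. *)

theory Defs
  imports "HOL-Algebra.Group"
begin

text \<open>
  Underlying sets are carriers, possibly empty in the case of S-posets. Orders are relations
  contained in carrier x carrier. Morphisms are extensional functions
  (undefined outside the carrier of their domain), so that equality of morphisms is
  HOL equality, composition is \<^const>\<open>compose\<close>, and the pointwise order on endomorphisms
  is antisymmetric.
\<close>

record 's pomonoid = "'s monoid" +
  mle :: "('s \<times> 's) set"

locale pomonoid = monoid S for S (structure) +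
  assumes mle_order: "partial_order_on (carrier S) (mle S)"
    and mle_mult: "\<lbrakk>(s, t) \<in> mle S; (s', t') \<in> mle S\<rbrakk> \<Longrightarrow> (s \<otimes> s', t \<otimes> t') \<in> mle S"

record 'a poset = "'a partial_object" +
  ple :: "('a \<times> 'a) set"

record ('a, 's) rposet = "'a poset" +
  ract :: "'a \<Rightarrow> 's \<Rightarrow> 'a"

record ('t, 'a) lposet = "'a poset" +
  lact :: "'t \<Rightarrow> 'a \<Rightarrow> 'a"

locale right_sposet = pomonoid S
  for S :: "'s pomonoid" (structure) and A :: "('a, 's) rposet" +
  assumes ple_order: "partial_order_on (carrier A) (ple A)"
    and ract_closed: "\<lbrakk>a \<in> carrier A; s \<in> carrier S\<rbrakk> \<Longrightarrow> ract A a s \<in> carrier A"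
    and ract_one: "a \<in> carrier A \<Longrightarrow> ract A a \<one> = a"
    and ract_mult: "\<lbrakk>a \<in> carrier A; s \<in> carrier S; t \<in> carrier S\<rbrakk>
      \<Longrightarrow> ract A a (s \<otimes> t) = ract A (ract A a s) t"
    and ract_mono: "\<lbrakk>(a, b) \<in> ple A; (s, t) \<in> mle S\<rbrakk> \<Longrightarrow> (ract A a s, ract A b t) \<in> ple A"

locale left_tposet = pomonoid T
  for T :: "'t pomonoid" (structure) and A :: "('t, 'a) lposet" +
  assumes ple_order: "partial_order_on (carrier A) (ple A)"
    and lact_closed: "\<lbrakk>t \<in> carrier T; a \<in> carrier A\<rbrakk> \<Longrightarrow> lact A t a \<in> carrier A"
    and lact_one: "a \<in> carrier A \<Longrightarrow> lact A \<one> a = a"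
    and lact_mult: "\<lbrakk>s \<in> carrier T; t \<in> carrier T; a \<in> carrier A\<rbrakk>
      \<Longrightarrow> lact A (s \<otimes> t) a = lact A s (lact A t a)"
    and lact_mono: "\<lbrakk>(s, t) \<in> mle T; (a, b) \<in> ple A\<rbrakk> \<Longrightarrow> (lact A s a, lact A t b) \<in> ple A"

definition rhom :: "'s pomonoid \<Rightarrow> ('a, 's) rposet \<Rightarrow> ('b, 's) rposet \<Rightarrow> ('a \<Rightarrow> 'b) set" where
  "rhom S A B = {h \<in> carrier A \<rightarrow>\<^sub>E carrier B.
     (\<forall>x y. (x, y) \<in> ple A \<longrightarrow> (h x, h y) \<in> ple B) \<and>
     (\<forall>a\<in>carrier A. \<forall>s\<in>carrier S. h (ract A a s) = ract B (h a) s)}"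

definition lhom :: "'t pomonoid \<Rightarrow> ('t, 'a) lposet \<Rightarrow> ('t, 'b) lposet \<Rightarrow> ('a \<Rightarrow> 'b) set" where
  "lhom T A B = {h \<in> carrier A \<rightarrow>\<^sub>E carrier B.
     (\<forall>x y. (x, y) \<in> ple A \<longrightarrow> (h x, h y) \<in> ple B) \<and>
     (\<forall>a\<in>carrier A. \<forall>t\<in>carrier T. h (lact A t a) = lact B t (h a))}"

definition order_embedding :: "'s pomonoid \<Rightarrow> ('a, 's) rposet \<Rightarrow> ('b, 's) rposet \<Rightarrow> ('a \<Rightarrow> 'b) \<Rightarrow> bool" where
  "order_embedding S A B h \<longleftrightarrow> h \<in> rhom S A B \<and>
     (\<forall>x\<in>carrier A. \<forall>y\<in>carrier A. (h x, h y) \<in> ple B \<longleftrightarrow> (x, y) \<in> ple A)"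

text \<open>
  The following notions quantify over all S-posets (or T-posets). HOL cannot quantify over
  types inside a formula, so the type argument names the type whose subsets serve as the
  carriers of these test objects. Over an infinite type \<open>'u\<close> containing the carriers of \<open>S\<close>
  and of the given S-posets, these are, up to isomorphism, all S-posets of cardinality at
  most that of \<open>'u\<close>; \<open>'u\<close> thus plays the role of a universe of sets.
\<close>

definition generator :: "'x itself \<Rightarrow> 's pomonoid \<Rightarrow> ('g, 's) rposet \<Rightarrow> bool" where
  "generator (U\<^sub>0 :: 'x itself) S G \<longleftrightarrow> right_sposet S G \<and>
     (\<forall>(X :: ('x, 's) rposet) (Y :: ('x, 's) rposet) \<alpha> \<beta>.
        right_sposet S X \<and> right_sposet S Y \<and> \<alpha> \<in> rhom S X Y \<and> \<beta> \<in> rhom S X Y \<and> \<alpha> \<noteq> \<beta> \<longrightarrow>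
        (\<exists>g\<in>rhom S G X. compose (carrier G) \<alpha> g \<noteq> compose (carrier G) \<beta> g))"

text \<open>
  Emb-injectivity of the object \<open>f : A \<rightarrow> B\<close> of the slice category over \<open>B\<close>, written out
  as the existence of a diagonal in every commutative square with an order-embedding on
  the left and \<open>f\<close> on the right.
\<close>

definition emb_injective_over ::
    "'x itself \<Rightarrow> 's pomonoid \<Rightarrow> ('a, 's) rposet \<Rightarrow> ('b, 's) rposet \<Rightarrow> ('a \<Rightarrow> 'b) \<Rightarrow> bool" where
  "emb_injective_over (U\<^sub>0 :: 'x itself) S A B f \<longleftrightarrow>
     right_sposet S A \<and> right_sposet S B \<and> f \<in> rhom S A B \<and>
     (\<forall>(U :: ('x, 's) rposet) (V :: ('x, 's) rposet) h u v.
        right_sposet S U \<and> right_sposet S V \<and> order_embedding S U V h \<and>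
        u \<in> rhom S U A \<and> v \<in> rhom S V B \<and>
        compose (carrier U) f u = compose (carrier U) v h \<longrightarrow>
        (\<exists>s\<in>rhom S V A. compose (carrier U) s h = u \<and> compose (carrier V) f s = v))"

text \<open>Epimorphisms of T-posets are exactly the surjective morphisms.\<close>

definition projective :: "'x itself \<Rightarrow> 't pomonoid \<Rightarrow> ('t, 'p) lposet \<Rightarrow> bool" where
  "projective (U\<^sub>0 :: 'x itself) T P \<longleftrightarrow> left_tposet T P \<and>
     (\<forall>(X :: ('t, 'x) lposet) (Y :: ('t, 'x) lposet) e q.
        left_tposet T X \<and> left_tposet T Y \<and> e \<in> lhom T X Y \<and> e ` carrier X = carrier Y \<and>
        q \<in> lhom T P Y \<longrightarrow>
        (\<exists>r\<in>lhom T P X. compose (carrier P) e r = q))"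

definition cyclic :: "'t pomonoid \<Rightarrow> ('t, 'a) lposet \<Rightarrow> bool" where
  "cyclic T A \<longleftrightarrow> left_tposet T A \<and>
     (\<exists>a\<in>carrier A. carrier A = (\<lambda>t. lact A t a) ` carrier T)"

definition End_pomonoid :: "'s pomonoid \<Rightarrow> ('a, 's) rposet \<Rightarrow> ('a \<Rightarrow> 'a) pomonoid" where
  "End_pomonoid S A =
     \<lparr>carrier = rhom S A A,
      mult = (\<lambda>g h. compose (carrier A) g h),
      one = (\<lambda>x\<in>carrier A. x),
      mle = {(g, h). g \<in> rhom S A A \<and> h \<in> rhom S A A \<and> (\<forall>a\<in>carrier A. (g a, h a) \<in> ple A)}\<rparr>"

definition End_lposet :: "('a, 's) rposet \<Rightarrow> ('a \<Rightarrow> 'a, 'a) lposet" where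
  "End_lposet A = \<lparr>carrier = carrier A, ple = ple A, lact = (\<lambda>h a. h a)\<rparr>"

end

theory Submission
  imports Defs
begin

text \<open>
  Maps out of a generator \<open>B\<close> jointly cover every \<open>S\<close>-poset \<open>X\<close>: otherwise the two inclusions of \<open>X\<close>
  into the amalgamated sum of two copies of \<open>X\<close> along the covered part \<open>I\<close> are distinct but agree
  after composition with every map out of \<open>B\<close>. For \<open>X = S\<close> this gives a map \<open>B \<rightarrow> S\<close> that hits \<open>1\<close>.
  Injectivity of \<open>f\<close> applied to the embedding of the empty \<open>S\<close>-poset into \<open>B\<close> yields a section of
  \<open>f\<close>, hence a map \<open>\<pi> : A \<rightarrow> S\<close> and \<open>a\<close> with \<open>\<pi>(a) = 1\<close>. Following \<open>\<pi>\<close> by \<open>s \<mapsto> x s\<close> shows that maps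
  out of \<open>A\<close> separate morphisms. The endomorphisms \<open>h\<^sub>c(z) = c \<pi>(z)\<close> satisfy \<open>h\<^sub>c(a) = c\<close> and
  \<open>h\<^bsub>g(c)\<^esub> = g h\<^sub>c\<close>, so \<open>a\<close> generates \<open>A\<close> over its endomorphisms, and a map \<open>q : A \<rightarrow> Y\<close> lifts along a
  surjection \<open>e : X \<rightarrow> Y\<close> by \<open>c \<mapsto> h\<^sub>c x\<close> for any \<open>x\<close> with \<open>e(x) = q(a)\<close>.
\<close>

section \<open>Elementary facts on orders and morphisms\<close>

lemma partial_order_on_iff:
  "partial_order_on A r \<longleftrightarrow>
     r \<subseteq> A \<times> A \<and> (\<forall>x\<in>A. (x, x) \<in> r) \<and>
     (\<forall>x y z. (x, y) \<in> r \<longrightarrow> (y, z) \<in> r \<longrightarrow> (x, z) \<in> r) \<and>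
     (\<forall>x y. (x, y) \<in> r \<longrightarrow> (y, x) \<in> r \<longrightarrow> x = y)"
  unfolding partial_order_on_def preorder_on_def refl_on_def trans_def antisym_def by blast

context pomonoid
begin

lemma mle_refl: "s \<in> carrier S \<Longrightarrow> (s, s) \<in> mle S"
  and mle_carrier: "(s, t) \<in> mle S \<Longrightarrow> s \<in> carrier S \<and> t \<in> carrier S"
  using mle_order unfolding partial_order_on_iff by blast+

end

context right_sposet
begin

lemma ple_refl: "x \<in> carrier A \<Longrightarrow> (x, x) \<in> ple A"
  and ple_carrier: "(x, y) \<in> ple A \<Longrightarrow> x \<in> carrier A \<and> y \<in> carrier A"
  and ple_antisym: "(x, y) \<in> ple A \<Longrightarrow> (y, x) \<in> ple A \<Longrightarrow> x = y"
  using ple_order unfolding partial_order_on_iff by blast+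

lemma ple_trans: "(x, y) \<in> ple A \<Longrightarrow> (y, z) \<in> ple A \<Longrightarrow> (x, z) \<in> ple A"
  using ple_order unfolding partial_order_on_iff by blast

end

lemma rhomI:
  assumes "h \<in> carrier A \<rightarrow>\<^sub>E carrier B"
    and "\<And>x y. (x, y) \<in> ple A \<Longrightarrow> (h x, h y) \<in> ple B"
    and "\<And>a s. a \<in> carrier A \<Longrightarrow> s \<in> carrier S \<Longrightarrow> h (ract A a s) = ract B (h a) s"
  shows "h \<in> rhom S A B"
  using assms unfolding rhom_def by auto

lemma rhomD:
  assumes "h \<in> rhom S A B"
  shows rhom_funcset: "h \<in> carrier A \<rightarrow>\<^sub>E carrier B"
    and rhom_closed: "a \<in> carrier A \<Longrightarrow> h a \<in> carrier B"
    and rhom_mono: "(x, y) \<in> ple A \<Longrightarrow> (h x, h y) \<in> ple B"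
    and rhom_ract: "a \<in> carrier A \<Longrightarrow> s \<in> carrier S \<Longrightarrow> h (ract A a s) = ract B (h a) s"
  using assms unfolding rhom_def by auto

lemma rhom_eqI:
  assumes "g \<in> rhom S A B" "h \<in> rhom S A B" "\<And>a. a \<in> carrier A \<Longrightarrow> g a = h a"
  shows "g = h"
  using assms by (meson PiE_ext rhom_funcset)

lemma lhomI:
  assumes "h \<in> carrier A \<rightarrow>\<^sub>E carrier B"
    and "\<And>x y. (x, y) \<in> ple A \<Longrightarrow> (h x, h y) \<in> ple B"
    and "\<And>a t. a \<in> carrier A \<Longrightarrow> t \<in> carrier T \<Longrightarrow> h (lact A t a) = lact B t (h a)"
  shows "h \<in> lhom T A B"
  using assms unfolding lhom_def by auto

lemma lhomD:
  assumes "h \<in> lhom T A B"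
  shows lhom_funcset: "h \<in> carrier A \<rightarrow>\<^sub>E carrier B"
    and lhom_closed: "a \<in> carrier A \<Longrightarrow> h a \<in> carrier B"
    and lhom_lact: "a \<in> carrier A \<Longrightarrow> t \<in> carrier T \<Longrightarrow> h (lact A t a) = lact B t (h a)"
  using assms unfolding lhom_def by auto

lemma rhom_id:
  assumes "right_sposet S A"
  shows "(\<lambda>x\<in>carrier A. x) \<in> rhom S A A"
proof -
  interpret right_sposet S A by fact
  show ?thesis
    by (rule rhomI) (auto dest: ple_carrier simp: ract_closed)
qed

lemma rhom_compose:
  assumes "right_sposet S A" and g: "g \<in> rhom S A B" and h: "h \<in> rhom S B C"
  shows "compose (carrier A) h g \<in> rhom S A C"
proof -
  interpret right_sposet S A by fact
  show ?thesis
    by (rule rhomI)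
      (use ple_carrier in \<open>auto simp: compose_def ract_closed rhom_closed[OF g] rhom_closed[OF h]
        rhom_ract[OF g] rhom_ract[OF h] intro!: rhom_mono[OF h] rhom_mono[OF g]\<close>)
qed

section \<open>The pomonoid as a right poset over itself\<close>

definition regular_rposet :: "'s pomonoid \<Rightarrow> ('s, 's) rposet" where
  "regular_rposet S = \<lparr>carrier = carrier S, ple = mle S, ract = mult S\<rparr>"

lemma regular_rposet_simps [simp]:
  "carrier (regular_rposet S) = carrier S"
  "ple (regular_rposet S) = mle S"
  "ract (regular_rposet S) = mult S"
  by (simp_all add: regular_rposet_def)

lemma right_sposet_regular:
  assumes "pomonoid S"
  shows "right_sposet S (regular_rposet S)"
proof -
  interpret pomonoid S by fact
  show ?thesis
    by unfold_locales (auto simp: mle_order mle_mult m_assoc)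
qed

text \<open>The regular \<open>S\<close>-poset is free on \<one>; this is the map that freeness
  provides for the value \<open>x\<close> at \<one>.\<close>

lemma (in right_sposet) orbit_map_rhom:
  assumes "x \<in> carrier A"
  shows "(\<lambda>s\<in>carrier S. ract A x s) \<in> rhom S (regular_rposet S) A"
  by (rule rhomI)
    (use assms mle_carrier in \<open>auto simp: ract_closed ract_mult intro!: ract_mono ple_refl\<close>)

section \<open>Transport of structure along an injection\<close>

text \<open>\<open>generator\<close> tests only objects over one fixed type, while the amalgam of a
  poset over \<open>'x\<close> lives on \<open>'x \<times> bool\<close>. This isomorphic copy brings
  it back into \<open>'x\<close>.\<close>

definition image_rposet :: "('a \<Rightarrow> 'b) \<Rightarrow> ('a, 's) rposet \<Rightarrow> ('b, 's) rposet" where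
  "image_rposet \<phi> X = \<lparr>carrier = \<phi> ` carrier X, ple = map_prod \<phi> \<phi> ` ple X,
     ract = (\<lambda>y s. \<phi> (ract X (the_inv \<phi> y) s))\<rparr>"

lemma image_rposet_simps:
  assumes "inj \<phi>"
  shows "carrier (image_rposet \<phi> X) = \<phi> ` carrier X"
    and "(\<phi> x, \<phi> y) \<in> ple (image_rposet \<phi> X) \<longleftrightarrow> (x, y) \<in> ple X"
    and "ract (image_rposet \<phi> X) (\<phi> x) s = \<phi> (ract X x s)"
  using assms by (auto simp: image_rposet_def inj_eq the_inv_f_f)

lemma right_sposet_image:
  assumes "inj \<phi>" and "right_sposet S X"
  shows "right_sposet S (image_rposet \<phi> X)"
proof -
  interpret right_sposet S X by fact
  note simps = image_rposet_simps[OF assms(1)]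
  have pleE: "\<exists>x y. p = \<phi> x \<and> q = \<phi> y \<and> (x, y) \<in> ple X" if "(p, q) \<in> ple (image_rposet \<phi> X)" for p q
    using that by (auto simp: image_rposet_def)
  have "partial_order_on (carrier (image_rposet \<phi> X)) (ple (image_rposet \<phi> X))"
    unfolding partial_order_on_iff
  proof (intro conjI allI impI subsetI ballI)
    fix p assume "p \<in> ple (image_rposet \<phi> X)"
    then show "p \<in> carrier (image_rposet \<phi> X) \<times> carrier (image_rposet \<phi> X)"
      by (auto simp: image_rposet_def dest: ple_carrier)
  next
    fix x assume "x \<in> carrier (image_rposet \<phi> X)"
    then show "(x, x) \<in> ple (image_rposet \<phi> X)"
      by (auto simp: simps ple_refl)
  next
    fix x y z assume "(x, y) \<in> ple (image_rposet \<phi> X)" "(y, z) \<in> ple (image_rposet \<phi> X)"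
    then show "(x, z) \<in> ple (image_rposet \<phi> X)"
      by (auto simp: simps inj_eq[OF assms(1)] dest!: pleE intro: ple_trans)
  next
    fix x y assume "(x, y) \<in> ple (image_rposet \<phi> X)" "(y, x) \<in> ple (image_rposet \<phi> X)"
    then show "x = y"
      by (auto simp: simps inj_eq[OF assms(1)] dest!: pleE intro: ple_antisym)
  qed
  then show ?thesis
    by unfold_locales
      (auto simp: simps ract_closed ract_one ract_mult dest!: pleE intro: ract_mono)
qed

lemma rhom_image:
  assumes "inj \<phi>" and "right_sposet S X"
  shows "(\<lambda>x\<in>carrier X. \<phi> x) \<in> rhom S X (image_rposet \<phi> X)"
proof -
  interpret right_sposet S X by fact
  show ?thesis
    by (rule rhomI) (auto simp: image_rposet_simps[OF assms(1)] ract_closed dest: ple_carrier)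
qed

section \<open>Amalgamated sum of two copies along a subset closed under the action\<close>

text \<open>
  The elements of \<open>I\<close> are represented by their copy with label \<^const>\<open>False\<close>.
\<close>

definition amalgam :: "('a, 's) rposet \<Rightarrow> 'a set \<Rightarrow> ('a \<times> bool, 's) rposet" where
  "amalgam X I =
     \<lparr>carrier = {(x, c). x \<in> carrier X \<and> (c \<longrightarrow> x \<notin> I)},
      ple = {((x, c), (y, d)). (x, y) \<in> ple X \<and> (c \<longrightarrow> x \<notin> I) \<and> (d \<longrightarrow> y \<notin> I) \<and>
               (c = d \<or> (\<exists>i\<in>I. (x, i) \<in> ple X \<and> (i, y) \<in> ple X))},
      ract = (\<lambda>(x, c) s. (ract X x s, c \<and> ract X x s \<notin> I))\<rparr>"

lemma amalgam_simps:
  "(x, c) \<in> carrier (amalgam X I) \<longleftrightarrow> x \<in> carrier X \<and> (c \<longrightarrow> x \<notin> I)"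
  "((x, c), (y, d)) \<in> ple (amalgam X I) \<longleftrightarrow>
     (x, y) \<in> ple X \<and> (c \<longrightarrow> x \<notin> I) \<and> (d \<longrightarrow> y \<notin> I) \<and>
     (c = d \<or> (\<exists>i\<in>I. (x, i) \<in> ple X \<and> (i, y) \<in> ple X))"
  "ract (amalgam X I) (x, c) s = (ract X x s, c \<and> ract X x s \<notin> I)"
  by (auto simp: amalgam_def)

context right_sposet
begin

context
  fixes I
  assumes I_carrier: "I \<subseteq> carrier A"
    and I_closed: "\<And>i s. i \<in> I \<Longrightarrow> s \<in> carrier S \<Longrightarrow> ract A i s \<in> I"
begin

lemma right_sposet_amalgam: "right_sposet S (amalgam A I)"
proof -
  have trans: "((x, b), (z, d)) \<in> ple (amalgam A I)"
    if "((x, b), (y, c)) \<in> ple (amalgam A I)" "((y, c), (z, d)) \<in> ple (amalgam A I)"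
    for x y z b c d
    using that unfolding amalgam_simps by (meson ple_trans)
  have antisym: "(x, c) = (y, d)"
    if "((x, c), (y, d)) \<in> ple (amalgam A I)" "((y, d), (x, c)) \<in> ple (amalgam A I)" for x y c d
  proof -
    have "x = y"
      using that by (auto simp: amalgam_simps intro: ple_antisym)
    \<comment> \<open>Different labels would put some element of \<open>I\<close> between
      \<open>x\<close> and itself, hence \<open>x\<close> in \<open>I\<close>, which the label
      \<open>True\<close> excludes.\<close>
    moreover have "i = x" if "(x, i) \<in> ple A" "(i, x) \<in> ple A" for i
      using that by (auto intro: ple_antisym)
    ultimately show ?thesis
      using that by (auto simp: amalgam_simps)
  qed
  have "partial_order_on (carrier (amalgam A I)) (ple (amalgam A I))"
    unfolding partial_order_on_iff
  proof (intro conjI)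
    show "ple (amalgam A I) \<subseteq> carrier (amalgam A I) \<times> carrier (amalgam A I)"
      by (auto simp: amalgam_simps dest: ple_carrier)
    show "\<forall>p\<in>carrier (amalgam A I). (p, p) \<in> ple (amalgam A I)"
      by (simp add: split_paired_all amalgam_simps ple_refl)
    show "\<forall>p q r. (p, q) \<in> ple (amalgam A I) \<longrightarrow> (q, r) \<in> ple (amalgam A I) \<longrightarrow>
        (p, r) \<in> ple (amalgam A I)"
      unfolding split_paired_All using trans by blast
    show "\<forall>p q. (p, q) \<in> ple (amalgam A I) \<longrightarrow> (q, p) \<in> ple (amalgam A I) \<longrightarrow> p = q"
      unfolding split_paired_All using antisym by blast
  qed
  moreover have "(ract (amalgam A I) (x, c) s, ract (amalgam A I) (y, d) t) \<in> ple (amalgam A I)"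
    if le: "((x, c), (y, d)) \<in> ple (amalgam A I)" and st: "(s, t) \<in> mle S" for x y c d s t
  proof -
    have s: "s \<in> carrier S" "t \<in> carrier S"
      using st mle_carrier by auto
    have xy: "(ract A x s, ract A y t) \<in> ple A"
      using le st by (auto simp: amalgam_simps intro: ract_mono)
    have cl: "ract A x s \<in> carrier A" "ract A y t \<in> carrier A"
      using xy ple_carrier by auto
    show ?thesis
    proof (cases "c = d")
      \<comment> \<open>Equal labels may become different under the action, when just one of the two
        products falls into \<open>I\<close>. That product is then itself the intermediate
        element.\<close>
      case True
      with xy cl show ?thesis
        by (auto simp: amalgam_simps intro: ple_refl)
    next
      \<comment> \<open>Since \<open>I\<close> is closed under the action, \<open>ract A i s\<close>
        is an intermediate element for the products.\<close>
      case False
      then obtain i where i: "i \<in> I" "(x, i) \<in> ple A" "(i, y) \<in> ple A"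
        using le by (auto simp: amalgam_simps)
      then have "(ract A x s, ract A i s) \<in> ple A" "(ract A i s, ract A y t) \<in> ple A"
        using s st by (auto intro: ract_mono mle_refl)
      with xy I_closed[OF i(1) s(1)] show ?thesis
        by (auto simp: amalgam_simps)
    qed
  qed
  ultimately show ?thesis
    by unfold_locales
      (auto simp: amalgam_simps ract_closed ract_one ract_mult I_closed split_paired_all
        intro: ract_mono)
qed

text \<open>The label \<open>c\<close> selects the copy. Elements of \<open>I\<close> always receive
  \<open>False\<close>, so on the carrier the inclusions for the two labels agree exactly on
  \<open>I\<close>.\<close>

lemma amalgam_inclusion_rhom:
  "(\<lambda>x\<in>carrier A. (x, c \<and> x \<notin> I)) \<in> rhom S A (amalgam A I)"
proof (rule rhomI)
  fix x y assume "(x, y) \<in> ple A"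
  then show "((\<lambda>x\<in>carrier A. (x, c \<and> x \<notin> I)) x, (\<lambda>x\<in>carrier A. (x, c \<and> x \<notin> I)) y)
      \<in> ple (amalgam A I)"
    using ple_carrier[of x y] ple_refl by (auto simp: amalgam_simps)
qed (auto simp: amalgam_simps ract_closed I_closed)

end

end

section \<open>Generators cover every \<open>S\<close>-poset\<close>

text \<open>An infinite cardinal absorbs the factor two. The infinitude of the universe enters the
  argument here.\<close>

lemma ex_inj_prod_bool:
  assumes "infinite (UNIV :: 'x set)"
  shows "\<exists>\<phi> :: 'x \<times> bool \<Rightarrow> 'x. inj \<phi>"
proof -
  have "(card_of (UNIV :: bool set), card_of (UNIV :: 'x set)) \<in> ordLeq"
    using assms
    by (intro ordLess_imp_ordLeq finite_ordLess_infinite card_of_Well_order) (auto simp: Field_card_of)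
  then have "(card_of ((UNIV :: 'x set) \<times> (UNIV :: bool set)), card_of (UNIV :: 'x set)) \<in> ordIso"
    using assms card_of_Times_infinite by blast
  then show ?thesis
    using card_of_ordIso[of "(UNIV :: 'x set) \<times> (UNIV :: bool set)" "UNIV :: 'x set"]
    by (auto simp: bij_betw_def)
qed

text \<open>If \<open>x\<close> were missed, the cokernel pair of the covered part would consist of
  two distinct maps that no map out of \<open>G\<close> separates.\<close>

lemma generator_covers:
  fixes S :: "'s pomonoid" and G :: "('g, 's) rposet" and X :: "('x, 's) rposet"
  assumes inf: "infinite (UNIV :: 'x set)"
    and gen: "generator TYPE('x) S G" and X: "right_sposet S X" and x: "x \<in> carrier X"
  shows "\<exists>g\<in>rhom S G X. x \<in> g ` carrier G"
proof (rule ccontr)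
  assume neg: "\<not> ?thesis"
  interpret X: right_sposet S X by fact
  interpret G: right_sposet S G using gen by (simp add: generator_def)
  define I where "I = (\<Union>g\<in>rhom S G X. g ` carrier G)"
  have I: "I \<subseteq> carrier X"
    by (auto simp: I_def rhom_closed)
  have I': "ract X i s \<in> I" if i: "i \<in> I" "s \<in> carrier S" for i s
  proof -
    obtain g b where gb: "g \<in> rhom S G X" "b \<in> carrier G" "i = g b"
      using i by (auto simp: I_def)
    then have "ract X i s = g (ract G b s)"
      using i by (simp add: rhom_ract)
    moreover have "ract G b s \<in> carrier G"
      using gb i by (simp add: G.ract_closed)
    ultimately show ?thesis
      using gb(1) unfolding I_def by blast
  qed
  obtain \<phi> :: "'x \<times> bool \<Rightarrow> 'x" where \<phi>: "inj \<phi>"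
    using ex_inj_prod_bool[OF inf] by blast
  let ?M = "amalgam X I"
  \<comment> \<open>The inclusion with label \<open>c\<close>, continued by \<phi> into a test
    object over \<open>'x\<close>.\<close>
  define j where
    "j c = compose (carrier X) (\<lambda>p\<in>carrier ?M. \<phi> p) (\<lambda>x\<in>carrier X. (x, c \<and> x \<notin> I))" for c
  have M: "right_sposet S ?M"
    using I I' by (rule X.right_sposet_amalgam)
  have j: "j c \<in> rhom S X (image_rposet \<phi> ?M)" for c
    unfolding j_def
    using X.right_sposet_axioms X.amalgam_inclusion_rhom[OF I I'] rhom_image[OF \<phi> M]
    by (rule rhom_compose)
  have j_apply: "j c y = \<phi> (y, c \<and> y \<notin> I)" if "y \<in> carrier X" for c y
    using that by (auto simp: j_def compose_def amalgam_simps)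
  have "x \<notin> I"
    using neg by (auto simp: I_def)
  then have "j True \<noteq> j False"
    using j_apply[OF x, of True] j_apply[OF x, of False] injD[OF \<phi>] by fastforce
  then obtain g where g: "g \<in> rhom S G X"
      "compose (carrier G) (j True) g \<noteq> compose (carrier G) (j False) g"
    using gen X right_sposet_image[OF \<phi> M] j unfolding generator_def by blast
  have "compose (carrier G) (j True) g = compose (carrier G) (j False) g"
  proof (rule ext)
    fix b
    show "compose (carrier G) (j True) g b = compose (carrier G) (j False) g b"
    proof (cases "b \<in> carrier G")
      case True
      \<comment> \<open>The definition of \<open>I\<close> absorbs every value of \<open>g\<close>,
        and on \<open>I\<close> both inclusions use the label \<open>False\<close>.\<close>
      then have "g b \<in> I" "g b \<in> carrier X"
        using g(1) by (auto simp: I_def rhom_closed)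
      then show ?thesis
        using True by (simp add: compose_def j_apply)
    qed (simp add: compose_def)
  qed
  with g(2) show False by contradiction
qed

text \<open>Take the square with the empty \<open>S\<close>-poset embedded into \<open>B\<close> on
  the left and the identity of \<open>B\<close> at the bottom. The lower triangle of its diagonal
  says that the diagonal is a section of \<open>f\<close>.\<close>

lemma emb_injective_over_section:
  fixes S :: "'s pomonoid" and B :: "('x, 's) rposet"
  assumes "emb_injective_over TYPE('x) S A B f"
  obtains s where "s \<in> rhom S B A" "compose (carrier B) f s = (\<lambda>x\<in>carrier B. x)"
proof -
  interpret B: right_sposet S B
    using assms by (simp add: emb_injective_over_def)
  define E :: "('x, 's) rposet" where "E = \<lparr>carrier = {}, ple = {}, ract = ract B\<rparr>"
  \<comment> \<open>An extensional function on the empty carrier is \<open>undefined\<close>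
    everywhere, so \<open>?z\<close> serves both as the embedding into \<open>B\<close> and as the
    map into \<open>A\<close>.\<close>
  let ?z = "\<lambda>x. undefined"
  have "right_sposet S E"
    by unfold_locales (auto simp: E_def)
  moreover have "order_embedding S E B ?z" "?z \<in> rhom S E A"
    by (auto simp: order_embedding_def rhom_def E_def)
  moreover have "compose (carrier E) f ?z = compose (carrier E) (\<lambda>x\<in>carrier B. x) ?z"
    by (auto simp: E_def compose_def)
  ultimately show thesis
    using assms that B.right_sposet_axioms rhom_id[OF B.right_sposet_axioms]
    unfolding emb_injective_over_def by blast
qed

section \<open>The endomorphism pomonoid and its action\<close>

lemma End_pomonoid_simps:
  "carrier (End_pomonoid S A) = rhom S A A"
  "mult (End_pomonoid S A) g h = compose (carrier A) g h"
  "one (End_pomonoid S A) = (\<lambda>x\<in>carrier A. x)"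
  "(g, h) \<in> mle (End_pomonoid S A) \<longleftrightarrow>
     g \<in> rhom S A A \<and> h \<in> rhom S A A \<and> (\<forall>a\<in>carrier A. (g a, h a) \<in> ple A)"
  by (simp_all add: End_pomonoid_def)

lemma End_lposet_simps [simp]:
  "carrier (End_lposet A) = carrier A"
  "ple (End_lposet A) = ple A"
  "lact (End_lposet A) h a = h a"
  by (simp_all add: End_lposet_def)

lemma pomonoid_End:
  assumes "right_sposet S A"
  shows "pomonoid (End_pomonoid S A)"
proof -
  interpret right_sposet S A by fact
  note [simp] = End_pomonoid_simps
  have "monoid (End_pomonoid S A)"
  proof
    fix g h k
    assume *: "g \<in> carrier (End_pomonoid S A)" "h \<in> carrier (End_pomonoid S A)"
      "k \<in> carrier (End_pomonoid S A)"
    show "g \<otimes>\<^bsub>End_pomonoid S A\<^esub> h \<otimes>\<^bsub>End_pomonoid S A\<^esub> k =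
        g \<otimes>\<^bsub>End_pomonoid S A\<^esub> (h \<otimes>\<^bsub>End_pomonoid S A\<^esub> k)"
      using * by (auto simp: compose_def fun_eq_iff rhom_closed)
  next
    fix g h
    assume "g \<in> carrier (End_pomonoid S A)" "h \<in> carrier (End_pomonoid S A)"
    then show "g \<otimes>\<^bsub>End_pomonoid S A\<^esub> h \<in> carrier (End_pomonoid S A)"
      using rhom_compose[OF assms] by simp
  next
    show "\<one>\<^bsub>End_pomonoid S A\<^esub> \<in> carrier (End_pomonoid S A)"
      using rhom_id[OF assms] by simp
  next
    fix g assume "g \<in> carrier (End_pomonoid S A)"
    then have g: "g \<in> carrier A \<rightarrow>\<^sub>E carrier A"
      by (simp add: rhom_funcset)
    show "\<one>\<^bsub>End_pomonoid S A\<^esub> \<otimes>\<^bsub>End_pomonoid S A\<^esub> g = g"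
      using g by (simp add: PiE_def Id_compose)
    show "g \<otimes>\<^bsub>End_pomonoid S A\<^esub> \<one>\<^bsub>End_pomonoid S A\<^esub> = g"
      using g by (auto simp: PiE_def intro: compose_Id)
  qed
  moreover have "partial_order_on (carrier (End_pomonoid S A)) (mle (End_pomonoid S A))"
    unfolding partial_order_on_iff
  proof (intro conjI allI impI)
    fix g h
    assume "(g, h) \<in> mle (End_pomonoid S A)" "(h, g) \<in> mle (End_pomonoid S A)"
    then show "g = h"
      by (intro rhom_eqI[of g S A A h] ple_antisym) auto
  next
    fix g h k
    assume "(g, h) \<in> mle (End_pomonoid S A)" "(h, k) \<in> mle (End_pomonoid S A)"
    then show "(g, k) \<in> mle (End_pomonoid S A)"
      using ple_trans by (simp, blast)
  qed (auto simp: ple_refl rhom_closed)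
  moreover have "(g \<otimes>\<^bsub>End_pomonoid S A\<^esub> g', h \<otimes>\<^bsub>End_pomonoid S A\<^esub> h') \<in> mle (End_pomonoid S A)"
    if "(g, h) \<in> mle (End_pomonoid S A)" "(g', h') \<in> mle (End_pomonoid S A)" for g h g' h'
  proof -
    have "(g (g' a), h (h' a)) \<in> ple A" if a: "a \<in> carrier A" for a
    proof -
      have "(g (g' a), g (h' a)) \<in> ple A" "(g (h' a), h (h' a)) \<in> ple A"
        using \<open>(g, h) \<in> _\<close> \<open>(g', h') \<in> _\<close> a by (auto simp: rhom_closed intro: rhom_mono)
      then show ?thesis by (rule ple_trans)
    qed
    then show ?thesis
      using that by (auto simp: compose_eq rhom_compose[OF assms])
  qed
  ultimately show ?thesis
    unfolding pomonoid_def pomonoid_axioms_def by blast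
qed

lemma left_tposet_End:
  assumes "right_sposet S A"
  shows "left_tposet (End_pomonoid S A) (End_lposet A)"
proof -
  interpret right_sposet S A by fact
  interpret E: pomonoid "End_pomonoid S A" using assms by (rule pomonoid_End)
  have "(g a, h b) \<in> ple A" if "(g, h) \<in> mle (End_pomonoid S A)" "(a, b) \<in> ple A" for g h a b
  proof -
    have "(g a, g b) \<in> ple A" "(g b, h b) \<in> ple A"
      using that ple_carrier[of a b] by (auto simp: End_pomonoid_simps intro: rhom_mono)
    then show ?thesis by (rule ple_trans)
  qed
  then show ?thesis
    by unfold_locales (auto simp: End_pomonoid_simps ple_order rhom_closed compose_eq)
qed

section \<open>Consequences of a map to \<open>S\<close> that attains \<one>\<close>

text \<open>
  Equivalently, \<open>S\<close> is a retract of \<open>A\<close>, since \<open>s \<mapsto> a s\<close> is a section of \<open>\<pi>\<close>.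
\<close>

locale unital_map = right_sposet S A
  for S :: "'s pomonoid" (structure) and A :: "('a, 's) rposet" +
  fixes \<pi> :: "'a \<Rightarrow> 's" and a :: 'a
  assumes \<pi>: "\<pi> \<in> rhom S A (regular_rposet S)"
    and a: "a \<in> carrier A"
    and \<pi>_a: "\<pi> a = \<one>"
begin

lemma \<pi>_closed: "z \<in> carrier A \<Longrightarrow> \<pi> z \<in> carrier S"
  using rhom_closed[OF \<pi>] by simp

text \<open>This is \<pi> followed by the orbit map of \<open>x\<close>. As
  \<open>\<pi> a = \<one>\<close>, it sends \<open>a\<close> to \<open>x\<close>, so
  \<open>a\<close> can be moved to any element of any \<open>S\<close>-poset.\<close>

lemma rhom_through_\<pi>:
  assumes "right_sposet S X" and "x \<in> carrier X"
  shows "(\<lambda>z\<in>carrier A. ract X x (\<pi> z)) \<in> rhom S A X"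
proof -
  interpret X: right_sposet S X by fact
  have "compose (carrier A) (\<lambda>s\<in>carrier S. ract X x s) \<pi> \<in> rhom S A X"
    using right_sposet_axioms \<pi> X.orbit_map_rhom[OF assms(2)] by (rule rhom_compose)
  also have "compose (carrier A) (\<lambda>s\<in>carrier S. ract X x s) \<pi> = (\<lambda>z\<in>carrier A. ract X x (\<pi> z))"
    by (auto simp: compose_def \<pi>_closed)
  finally show ?thesis .
qed

text \<open>A point where two maps differ is the value at \<open>a\<close> of a map through \<pi>,
  which therefore separates them. This works over every test type \<open>'x\<close>.\<close>

lemma generator: "generator TYPE('x) S A"
  unfolding generator_def
proof (intro conjI allI impI right_sposet_axioms)
  fix X Y :: "('x, 's) rposet" and \<alpha> \<beta>
  assume "right_sposet S X \<and> right_sposet S Y \<and> \<alpha> \<in> rhom S X Y \<and> \<beta> \<in> rhom S X Y \<and> \<alpha> \<noteq> \<beta>"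
  then have X: "right_sposet S X" and \<alpha>: "\<alpha> \<in> rhom S X Y" and \<beta>: "\<beta> \<in> rhom S X Y" and "\<alpha> \<noteq> \<beta>"
    by auto
  then obtain x where x: "x \<in> carrier X" "\<alpha> x \<noteq> \<beta> x"
    using rhom_eqI[OF \<alpha> \<beta>] by blast
  let ?g = "\<lambda>z\<in>carrier A. ract X x (\<pi> z)"
  have "?g a = x"
    using right_sposet.ract_one[OF X x(1)] by (simp add: a \<pi>_a)
  then have "compose (carrier A) \<alpha> ?g a \<noteq> compose (carrier A) \<beta> ?g a"
    using x(2) a by (simp add: compose_eq)
  with rhom_through_\<pi>[OF X x(1)]
  show "\<exists>g\<in>rhom S A X. compose (carrier A) \<alpha> g \<noteq> compose (carrier A) \<beta> g"
    by metis
qed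

definition endo :: "'a \<Rightarrow> 'a \<Rightarrow> 'a" where
  "endo c = (\<lambda>z\<in>carrier A. ract A c (\<pi> z))"

lemma endo_rhom: "c \<in> carrier A \<Longrightarrow> endo c \<in> rhom S A A"
  unfolding endo_def using right_sposet_axioms by (rule rhom_through_\<pi>)

lemma endo_a: "c \<in> carrier A \<Longrightarrow> endo c a = c"
  by (simp add: endo_def a \<pi>_a ract_one)

lemma endo_mono: "(b, c) \<in> ple A \<Longrightarrow> (endo b, endo c) \<in> mle (End_pomonoid S A)"
  using ple_carrier[of b c] endo_rhom
  by (auto simp: End_pomonoid_simps endo_def \<pi>_closed intro!: ract_mono mle_refl)

text \<open>An endomorphism \<open>g\<close> commutes with the action of \<open>\<pi> z\<close>.
  Together with \<open>endo_a\<close> and \<open>endo_mono\<close>, this makes \<open>endo\<close>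
  an equivariant monotone section of evaluation at \<open>a\<close>, so \<open>A\<close> is a
  retract of the free cyclic left poset over its endomorphisms.\<close>

lemma endo_apply:
  assumes "g \<in> rhom S A A" "c \<in> carrier A"
  shows "endo (g c) = compose (carrier A) g (endo c)"
  using assms by (auto simp: endo_def compose_def fun_eq_iff \<pi>_closed rhom_ract)

lemma cyclic_End: "cyclic (End_pomonoid S A) (End_lposet A)"
  unfolding cyclic_def
proof (intro conjI bexI)
  show "carrier (End_lposet A) = (\<lambda>t. lact (End_lposet A) t a) ` carrier (End_pomonoid S A)"
  proof
    show "carrier (End_lposet A) \<subseteq> (\<lambda>t. lact (End_lposet A) t a) ` carrier (End_pomonoid S A)"
    proof
      fix c assume "c \<in> carrier (End_lposet A)"
      then show "c \<in> (\<lambda>t. lact (End_lposet A) t a) ` carrier (End_pomonoid S A)"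
        using endo_rhom endo_a by (intro image_eqI[of _ _ "endo c"]) (auto simp: End_pomonoid_simps)
    qed
  qed (use a in \<open>auto simp: End_pomonoid_simps rhom_closed\<close>)
qed (use a left_tposet_End[OF right_sposet_axioms] in auto)

text \<open>Only the value at \<open>a\<close> has to be lifted along \<open>e\<close>;
  \<open>endo\<close> extends this choice to all of \<open>A\<close> monotonically and
  equivariantly.\<close>

lemma projective_End: "projective TYPE('y) (End_pomonoid S A) (End_lposet A)"
  unfolding projective_def
proof (intro conjI allI impI left_tposet_End right_sposet_axioms)
  let ?T = "End_pomonoid S A"
  fix X Y :: "('a \<Rightarrow> 'a, 'y) lposet" and e q
  assume "left_tposet ?T X \<and> left_tposet ?T Y \<and> e \<in> lhom ?T X Y \<and>
    e ` carrier X = carrier Y \<and> q \<in> lhom ?T (End_lposet A) Y"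
  then have "left_tposet ?T X" and e: "e \<in> lhom ?T X Y" and surj: "e ` carrier X = carrier Y"
    and q: "q \<in> lhom ?T (End_lposet A) Y" by auto
  interpret X: left_tposet ?T X by fact
  have "q a \<in> e ` carrier X"
    using lhom_closed[OF q] a surj by simp
  then obtain x where x: "x \<in> carrier X" "e x = q a"
    by auto
  have endo_carrier: "endo c \<in> carrier ?T" if "c \<in> carrier A" for c
    using that by (simp add: End_pomonoid_simps endo_rhom)
  have x_refl: "(x, x) \<in> ple X"
    using X.ple_order x(1) unfolding partial_order_on_iff by blast
  \<comment> \<open>\<open>endo\<close> followed by the map out of the free cyclic poset that sends
    the identity to \<open>x\<close>.\<close>
  define r where "r = (\<lambda>c\<in>carrier A. lact X (endo c) x)"
  have "r \<in> lhom ?T (End_lposet A) X"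
  proof (rule lhomI)
    show "r \<in> carrier (End_lposet A) \<rightarrow>\<^sub>E carrier X"
      using x(1) by (auto simp: r_def endo_carrier X.lact_closed)
  next
    fix b c assume "(b, c) \<in> ple (End_lposet A)"
    then have "(b, c) \<in> ple A" "b \<in> carrier A" "c \<in> carrier A"
      using ple_carrier by auto
    then show "(r b, r c) \<in> ple X"
      using x_refl by (simp add: r_def endo_mono X.lact_mono)
  next
    fix c g assume "c \<in> carrier (End_lposet A)" "g \<in> carrier ?T"
    then have c: "c \<in> carrier A" and g: "g \<in> rhom S A A"
      by (auto simp: End_pomonoid_simps)
    \<comment> \<open>By \<open>endo_apply\<close>, \<open>endo (g c)\<close> is the product of
      \<open>g\<close> and \<open>endo c\<close> in \<open>?T\<close>.\<close>
    then have "lact X (endo (g c)) x = lact X g (lact X (endo c) x)"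
      using X.lact_mult[of g "endo c" x] x(1)
      by (simp add: End_pomonoid_simps endo_apply endo_rhom)
    then show "r (lact (End_lposet A) g c) = lact X g (r c)"
      using c g by (simp add: r_def rhom_closed)
  qed
  moreover have "compose (carrier (End_lposet A)) e r = q"
  proof (rule PiE_ext)
    show "q \<in> carrier (End_lposet A) \<rightarrow>\<^sub>E carrier Y"
      using q by (rule lhom_funcset)
    show "compose (carrier (End_lposet A)) e r \<in> carrier (End_lposet A) \<rightarrow>\<^sub>E carrier Y"
      using x(1) by (auto simp: compose_def r_def endo_carrier X.lact_closed lhom_closed[OF e])
    fix c assume "c \<in> carrier (End_lposet A)"
    then have c: "c \<in> carrier A" by simp
    have "e (r c) = lact Y (endo c) (q a)"
      using c x by (simp add: r_def lhom_lact[OF e] endo_carrier)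
    also have "\<dots> = q (endo c a)"
      using lhom_lact[OF q, of a "endo c"] a c by (simp add: endo_carrier)
    finally show "compose (carrier (End_lposet A)) e r c = q c"
      using c by (simp add: compose_eq endo_a)
  qed
  ultimately show "\<exists>r\<in>lhom ?T (End_lposet A) X. compose (carrier (End_lposet A)) e r = q"
    by blast
qed

end

theorem theorem3p10:
  fixes S :: "'u pomonoid"
    and A B :: "('u, 'u) rposet"
    and f :: "'u \<Rightarrow> 'u"
  assumes universe: "infinite (UNIV :: 'u set)"
    and "pomonoid S"
    and "right_sposet S A"
    and "right_sposet S B"
    and "f \<in> rhom S A B"
    and "emb_injective_over TYPE('u) S A B f"
    and "generator TYPE('u) S B"
  shows "generator TYPE('x) S A \<and>
         cyclic (End_pomonoid S A) (End_lposet A) \<and>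
         projective TYPE('y) (End_pomonoid S A) (End_lposet A)"
proof -
  interpret S: pomonoid S by fact
  \<comment> \<open>The covering property is applied to the element \<one> of the regular
    \<open>S\<close>-poset.\<close>
  obtain p b where p: "p \<in> rhom S B (regular_rposet S)" "b \<in> carrier B" "p b = \<one>\<^bsub>S\<^esub>"
    using generator_covers[OF universe \<open>generator TYPE('u) S B\<close>
        right_sposet_regular[OF \<open>pomonoid S\<close>], of "\<one>\<^bsub>S\<^esub>"] by auto
  obtain s where s: "s \<in> rhom S B A" "compose (carrier B) f s = (\<lambda>x\<in>carrier B. x)"
    using emb_injective_over_section[OF \<open>emb_injective_over TYPE('u) S A B f\<close>] .
  \<comment> \<open>The section carries \<open>b\<close> to a point of \<open>A\<close> at which
    \<open>p\<close> after \<open>f\<close> takes the value \<one>.\<close>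
  have "f (s b) = b"
    using fun_cong[OF s(2), of b] p(2) by (simp add: compose_eq)
  then have "compose (carrier A) p f (s b) = \<one>\<^bsub>S\<^esub>"
    using p s(1) by (simp add: compose_eq rhom_closed)
  then interpret unital_map S A "compose (carrier A) p f" "s b"
    using assms(3) p s(1) rhom_compose[OF assms(3,5) p(1)]
    by (simp add: unital_map_def unital_map_axioms_def rhom_closed)
  show ?thesis
    using generator cyclic_End projective_End by blast
qed

end
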